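(* Let $n\ge1$ be an integer. For every $c\in\mathbb{R}^n$, $$\sum_{j\ge0}m_j\ \le\ \Bigl(\frac12+\frac1{2\ln2}\Bigr)n^2\ <\ 1.222\,n^2,$$ where, for each integer $j\ge 0$, $m_j:=\min_{\tau\in I_j}D_c(\tau)$.
   Context: For integers $j\ge0$, $I_j:=[2^{-j-1},2^{-j}]\subseteq\mathbb{R}$. For $c\in\mathbb{R}^n$ and $\tau\in\mathbb{R}$, $D_c(\tau):=\min_{z\in\mathbb{Z}^n}\lVert\tau c-z\rVert_1$ is the $\ell_1$-distance of $\tau c$ to $\mathbb{Z}^n$. The function $D_c$ is continuous, so the minimum defining $m_j$ over the compact interval $I_j$ exists. The sum is over all integers $j\ge0$; its terms are nonnegative, and the bound includes the assertion that the series converges. *)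

theory Defs
  imports "HOL-Analysis.Analysis"
begin

definition l1_norm :: "real ^ 'n \<Rightarrow> real" where
  "l1_norm x = (\<Sum>i\<in>UNIV. \<bar>x $ i\<bar>)"

definition int_lattice :: "(real ^ 'n) set" where
  "int_lattice = {z. \<forall>i. z $ i \<in> \<int>}"

definition dyadic_interval :: "nat \<Rightarrow> real set" where
  "dyadic_interval j = {2 powr (- real j - 1) .. 2 powr (- real j)}"

text \<open>The two minima below are taken over infinite sets and are written as infima;
  \<open>lattice_dist_attained\<close> and \<open>min_dist_attained\<close> show that both are attained.\<close>

definition lattice_dist :: "real ^ 'n \<Rightarrow> real \<Rightarrow> real" where
  "lattice_dist c \<tau> = (INF z\<in>int_lattice. l1_norm (\<tau> *\<^sub>R c - z))"

definition min_dist :: "real ^ 'n \<Rightarrow> nat \<Rightarrow> real" where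
  "min_dist c j = (INF \<tau>\<in>dyadic_interval j. lattice_dist c \<tau>)"

lemma l1_norm_triangle: "l1_norm (x + y) \<le> l1_norm x + l1_norm y"
  unfolding l1_norm_def sum.distrib[symmetric] by (intro sum_mono) auto

lemma l1_norm_nonneg: "0 \<le> l1_norm x"
  unfolding l1_norm_def by (simp add: sum_nonneg)

lemma l1_norm_scaleR: "l1_norm (a *\<^sub>R x) = \<bar>a\<bar> * l1_norm x"
  unfolding l1_norm_def by (simp add: abs_mult sum_distrib_left)

lemma round_minimal:
  fixes x :: real
  assumes "k \<in> \<int>"
  shows "\<bar>x - of_int (round x)\<bar> \<le> \<bar>x - k\<bar>"
  using assms round_diff_minimal[of x] by (auto elim: Ints_cases)

lemma lattice_dist_attained:
  "\<exists>z\<in>int_lattice. lattice_dist c \<tau> = l1_norm (\<tau> *\<^sub>R c - z) \<and>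
     (\<forall>w\<in>int_lattice. l1_norm (\<tau> *\<^sub>R c - z) \<le> l1_norm (\<tau> *\<^sub>R c - w))"
proof -
  define z :: "real ^ 'a" where "z = (\<chi> i. of_int (round (\<tau> * c $ i)))"
  have z: "z \<in> int_lattice"
    by (simp add: z_def int_lattice_def)
  have le: "l1_norm (\<tau> *\<^sub>R c - z) \<le> l1_norm (\<tau> *\<^sub>R c - w)" if "w \<in> int_lattice" for w
    using that unfolding l1_norm_def z_def int_lattice_def
    by (intro sum_mono) (simp add: round_minimal)
  have "lattice_dist c \<tau> = l1_norm (\<tau> *\<^sub>R c - z)"
    unfolding lattice_dist_def using z le by (intro cInf_eq_minimum) auto
  then show ?thesis
    using z le by blast
qed

lemma lattice_dist_diff: "lattice_dist c s \<le> lattice_dist c t + \<bar>s - t\<bar> * l1_norm c"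
proof -
  obtain z where z: "z \<in> int_lattice" "lattice_dist c t = l1_norm (t *\<^sub>R c - z)"
    using lattice_dist_attained by blast
  have "lattice_dist c s \<le> l1_norm (s *\<^sub>R c - z)"
    using lattice_dist_attained[of c s] z(1) by auto
  also have "s *\<^sub>R c - z = (t *\<^sub>R c - z) + (s - t) *\<^sub>R c"
    by (simp add: algebra_simps)
  also have "l1_norm \<dots> \<le> l1_norm (t *\<^sub>R c - z) + l1_norm ((s - t) *\<^sub>R c)"
    by (rule l1_norm_triangle)
  finally show ?thesis
    by (simp add: z(2) l1_norm_scaleR)
qed

lemma continuous_lattice_dist: "continuous_on S (lattice_dist c)"
proof -
  have "(l1_norm c)-lipschitz_on S (lattice_dist c)"
  proof (rule lipschitz_onI)
    fix s t
    show "dist (lattice_dist c s) (lattice_dist c t) \<le> l1_norm c * dist s t"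
      using lattice_dist_diff[of c s t] lattice_dist_diff[of c t s]
      by (auto simp: dist_real_def abs_minus_commute mult.commute abs_le_iff)
  qed (rule l1_norm_nonneg)
  then show ?thesis
    by (rule lipschitz_on_continuous_on)
qed

lemma min_dist_attained:
  "\<exists>\<tau>\<in>dyadic_interval j. min_dist c j = lattice_dist c \<tau> \<and>
     (\<forall>s\<in>dyadic_interval j. lattice_dist c \<tau> \<le> lattice_dist c s)"
proof -
  have "compact (dyadic_interval j)" "dyadic_interval j \<noteq> {}"
    by (auto simp: dyadic_interval_def)
  then obtain \<tau> where \<tau>: "\<tau> \<in> dyadic_interval j"
    "\<forall>s\<in>dyadic_interval j. lattice_dist c \<tau> \<le> lattice_dist c s"
    using continuous_attains_inf continuous_lattice_dist by metis
  then have "min_dist c j = lattice_dist c \<tau>"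
    unfolding min_dist_def by (intro cInf_eq_minimum) auto
  then show ?thesis
    using \<tau> by blast
qed

end

theory Submission imports Defs begin

text \<open>
  Write \<open>n\<close> for the dimension, \<open>D\<close> for \<open>lattice_dist c\<close>, and \<open>m\<^sub>j\<close> for the minimum of \<open>D\<close> over
  the \<open>j\<close>-th dyadic interval. The core of the proof is a bound on how many of the \<open>m\<^sub>j\<close> can be
  large (\<open>le_of_le_min_dist\<close>): if \<open>m\<^sub>j \<ge> x\<close> for all \<open>j\<close> in a nonempty set of size \<open>k\<close>, then
  \<open>x \<le> n * 2 powr (- k / n)\<close>.

  For this bound, consider the \<open>2 ^ K\<close> points \<open>\<tau> = i / 2 ^ K\<close> of \<open>[0, 1)\<close>, with \<open>K\<close> exceeding
  all these \<open>j\<close>, and the points \<open>\<tau> c\<close> of the torus \<open>\<real>\<^sup>n / \<int>\<^sup>n\<close>. Averaging over the translates of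
  a cube of side \<open>q\<close>, one coordinate at a time, yields at least \<open>q ^ n * 2 ^ K\<close> indices whose points
  lie in a common cube (\<open>pigeonhole_torus\<close>). Two such parameters have a difference \<open>\<tau>\<close> with
  \<open>D \<tau> < n * q\<close>. If \<open>m\<^sub>j \<ge> n * q\<close> for \<open>k\<close> values of \<open>j\<close>, no difference lies in any of the
  corresponding \<open>k\<close> dyadic intervals, and such a set of indices has at most \<open>2 ^ (K - k)\<close>
  elements (\<open>card_mult_le_of_gaps\<close>). Hence \<open>q ^ n * 2 ^ k \<le> 1\<close>.

  Consequently the \<open>k\<close>-th largest of the \<open>m\<^sub>j\<close> is at most \<open>n * 2 powr (- k / n)\<close>; it is also at
  most \<open>n / 2\<close>, because every real number is within \<open>1 / 2\<close> of an integer. Using the second bound for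
  \<open>k \<le> n\<close> and the first for \<open>k > n\<close> bounds the sum by
  \<open>n\<^sup>2 / 2 + (n / 2) / (2 powr (1 / n) - 1)\<close>, and \<open>2 powr (1 / n) \<ge> 1 + ln 2 / n\<close>.
\<close>

section \<open>Sets of integers whose differences avoid dyadic scales\<close>

text \<open>The premises say that all differences are below \<open>2 ^ a\<close> and avoid \<open>[2 ^ b, 2 ^ (b + 1))\<close> for
  each \<open>b \<in> J\<close>. Each forbidden scale below \<open>a\<close> halves the trivial bound \<open>2 ^ a\<close> on the size of
  the set.\<close>

lemma card_mult_le_of_gaps:
  fixes S J :: "nat set"
  assumes "finite S"
    and "\<And>x y. x \<in> S \<Longrightarrow> y \<in> S \<Longrightarrow> x < y \<Longrightarrow> y - x < 2 ^ a"
    and "\<And>x y b. x \<in> S \<Longrightarrow> y \<in> S \<Longrightarrow> x < y \<Longrightarrow> b \<in> J \<Longrightarrow> 2 ^ b \<le> y - x \<Longrightarrow> 2 ^ Suc b \<le> y - x"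
  shows "card S * 2 ^ card (J \<inter> {..<a}) \<le> 2 ^ a"
  using assms
proof (induction a arbitrary: S)
  case 0
  have "x = y" if "x \<in> S" "y \<in> S" for x y
    using "0.prems"(2)[OF that] "0.prems"(2)[OF that(2,1)] by (cases x y rule: linorder_cases) auto
  then have "card S \<le> 1"
    by (simp add: card_le_Suc0_iff_eq[OF \<open>finite S\<close>])
  then show ?case by simp
next
  case (Suc a)
  show ?case
  proof (cases "a \<in> J")
    case True
    \<comment> \<open>The top scale is forbidden, so the differences are already below \<open>2 ^ a\<close>.\<close>
    have "card S * 2 ^ card (J \<inter> {..<a}) \<le> 2 ^ a"
    proof (rule Suc.IH[OF Suc.prems(1)])
      fix x y assume xy: "x \<in> S" "y \<in> S" "x < y"
      show "y - x < 2 ^ a"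
        using Suc.prems(2)[OF xy] Suc.prems(3)[OF xy True] by fastforce
    qed (rule Suc.prems(3))
    moreover have "J \<inter> {..<Suc a} = insert a (J \<inter> {..<a})"
      using True by (auto simp: less_Suc_eq)
    ultimately show ?thesis by simp
  next
    case False
    then have J: "J \<inter> {..<Suc a} = J \<inter> {..<a}"
      by (auto simp: less_Suc_eq)
    \<comment> \<open>Split \<open>S\<close> into two parts whose differences are below \<open>2 ^ a\<close>.\<close>
    define lo where "lo = {x \<in> S. x < Min S + 2 ^ a}"
    define hi where "hi = {x \<in> S. Min S + 2 ^ a \<le> x}"
    have S: "S = lo \<union> hi" "lo \<inter> hi = {}" "lo \<subseteq> S" "hi \<subseteq> S"
      by (auto simp: lo_def hi_def)
    then have fin: "finite lo" "finite hi"
      using \<open>finite S\<close> finite_subset by blast+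
    have "card lo * 2 ^ card (J \<inter> {..<a}) \<le> 2 ^ a"
    proof (rule Suc.IH[OF fin(1)])
      fix x y assume xy: "x \<in> lo" "y \<in> lo" "x < y"
      then have "Min S \<le> x"
        using \<open>finite S\<close> by (auto simp: lo_def)
      with xy show "y - x < 2 ^ a" by (auto simp: lo_def)
    qed (use S(3) Suc.prems(3) in blast)
    moreover have "card hi * 2 ^ card (J \<inter> {..<a}) \<le> 2 ^ a"
    proof (rule Suc.IH[OF fin(2)])
      fix x y assume xy: "x \<in> hi" "y \<in> hi" "x < y"
      then have ne: "S \<noteq> {}" and y: "y \<in> S" "Min S + 2 ^ a \<le> x" "Min S \<le> x"
        by (auto simp: hi_def)
      have "y - Min S < 2 ^ Suc a"
        by (rule Suc.prems(2)[OF Min_in[OF \<open>finite S\<close> ne] y(1)]) (use y xy in simp)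
      with xy y show "y - x < 2 ^ a" by simp
    qed (use S(4) Suc.prems(3) in blast)
    moreover have "card S = card lo + card hi"
      using S(1,2) fin by (metis card_Un_disjoint)
    ultimately show ?thesis
      unfolding J by (simp add: add_mult_distrib)
  qed
qed

section \<open>Pigeonhole principle on the torus\<close>

lemma card_shifts_residue:
  fixes p :: int and s L :: nat
  assumes "s \<le> L" "0 < L"
  shows "card {a \<in> {0..<int L}. (p - a) mod int L < int s} = s"
proof -
  have "bij_betw (\<lambda>a. (p - a) mod int L) {a \<in> {0..<int L}. (p - a) mod int L < int s} {0..<int s}"
    by (rule bij_betw_byWitness[where f' = "\<lambda>u. (p - u) mod int L"])
       (use assms in \<open>auto simp: mod_diff_right_eq\<close>)
  then show ?thesis
    by (simp add: bij_betw_same_card)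
qed

text \<open>Some half-open arc of length \<open>s / L\<close> on the circle \<open>\<real> / \<int>\<close> contains at least the average
  share \<open>s / L\<close> of the points \<open>f x\<close>. The circle is divided into \<open>L\<close> equal cells, and the average is
  over the \<open>L\<close> arcs that consist of \<open>s\<close> consecutive cells.\<close>

lemma pigeonhole_arc:
  fixes f :: "'a \<Rightarrow> real" and s L :: nat
  assumes "finite S" "s \<le> L" "0 < L"
  shows "\<exists>T\<subseteq>S. s * card S \<le> L * card T \<and>
    (\<forall>x\<in>T. \<forall>y\<in>T. \<exists>k::int. \<bar>f x - f y - of_int k\<bar> < real s / real L)"
proof -
  define p where "p x = \<lfloor>real L * f x\<rfloor>" for x
  define T where "T a = {x \<in> S. (p x - a) mod int L < int s}" for a
  have "(\<Sum>a\<in>{0..<int L}. card (T a))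
      = (\<Sum>a\<in>{0..<int L}. \<Sum>x\<in>S. of_bool ((p x - a) mod int L < int s))"
    unfolding T_def using \<open>finite S\<close>
    by (intro sum.cong refl) (simp add: sum_of_bool_eq Int_def)
  also have "\<dots> = (\<Sum>x\<in>S. \<Sum>a\<in>{0..<int L}. of_bool ((p x - a) mod int L < int s))"
    by (rule sum.swap)
  also have "\<dots> = (\<Sum>x\<in>S. card {a \<in> {0..<int L}. (p x - a) mod int L < int s})"
    by (intro sum.cong refl) (simp add: sum_of_bool_eq Int_def)
  also have "\<dots> = s * card S"
    by (simp only: card_shifts_residue[OF assms(2,3)]) simp
  finally have total: "(\<Sum>a\<in>{0..<int L}. card (T a)) = s * card S" .
  have "\<exists>a\<in>{0..<int L}. s * card S \<le> L * card (T a)"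
  proof (rule ccontr)
    assume "\<not> ?thesis"
    then have "(\<Sum>a\<in>{0..<int L}. L * card (T a)) < (\<Sum>a\<in>{0..<int L}. s * card S)"
      using \<open>0 < L\<close> by (intro sum_strict_mono) (auto simp: not_le)
    then show False
      by (simp add: sum_distrib_left[symmetric] total)
  qed
  then obtain a where a: "s * card S \<le> L * card (T a)" by blast
  have "\<exists>k::int. \<bar>f x - f y - of_int k\<bar> < real s / real L" if "x \<in> T a" "y \<in> T a" for x y
  proof -
    define u v where "u = (p x - a) mod int L" and "v = (p y - a) mod int L"
    define k where "k = (p x - a) div int L - (p y - a) div int L"
    have uv: "0 \<le> u" "u < int s" "0 \<le> v" "v < int s"
      using that \<open>0 < L\<close> by (auto simp: T_def u_def v_def)
    have "p x - a = int L * ((p x - a) div int L) + u" "p y - a = int L * ((p y - a) div int L) + v"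
      by (simp_all add: u_def v_def)
    then have "p x - p y = int L * k + (u - v)"
      unfolding k_def right_diff_distrib by linarith
    then have "real_of_int (p x) - real_of_int (p y) = real L * of_int k + (of_int u - of_int v)"
      by (metis of_int_add of_int_diff of_int_mult of_int_of_nat_eq)
    moreover have "real_of_int (p x) \<le> real L * f x" "real L * f x < real_of_int (p x) + 1"
      "real_of_int (p y) \<le> real L * f y" "real L * f y < real_of_int (p y) + 1"
      by (simp_all add: p_def)
    \<comment> \<open>Integrality of \<open>u\<close> and \<open>v\<close> gains the \<open>1\<close> that pays for the error from rounding down.\<close>
    moreover have "\<bar>real_of_int u - real_of_int v\<bar> \<le> real s - 1"
      using uv by linarith
    ultimately have "\<bar>real L * f x - real L * f y - real L * of_int k\<bar> < real s"
      by linarith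
    also have "real L * f x - real L * f y - real L * of_int k = real L * (f x - f y - of_int k)"
      by (simp add: algebra_simps)
    finally have "real L * \<bar>f x - f y - of_int k\<bar> < real s"
      by (simp add: abs_mult)
    then have "\<bar>f x - f y - of_int k\<bar> < real s / real L"
      using \<open>0 < L\<close> by (simp add: pos_less_divide_eq mult.commute)
    then show ?thesis ..
  qed
  then show ?thesis
    using a by (intro exI[of _ "T a"]) (auto simp: T_def)
qed

lemma pigeonhole_torus:
  fixes f :: "'b \<Rightarrow> 'a \<Rightarrow> real" and s L :: nat
  assumes "finite S" "s \<le> L" "0 < L" "finite B"
  shows "\<exists>T\<subseteq>S. s ^ card B * card S \<le> L ^ card B * card T \<and>
    (\<forall>x\<in>T. \<forall>y\<in>T. \<forall>l\<in>B. \<exists>k::int. \<bar>f l x - f l y - of_int k\<bar> < real s / real L)"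
  using \<open>finite B\<close>
proof induction
  case empty
  show ?case by auto
next
  case (insert b B)
  then obtain T where T: "T \<subseteq> S" "s ^ card B * card S \<le> L ^ card B * card T"
    "\<forall>x\<in>T. \<forall>y\<in>T. \<forall>l\<in>B. \<exists>k::int. \<bar>f l x - f l y - of_int k\<bar> < real s / real L"
    by blast
  have "finite T"
    using T(1) \<open>finite S\<close> by (rule finite_subset)
  obtain T' where T': "T' \<subseteq> T" "s * card T \<le> L * card T'"
    "\<forall>x\<in>T'. \<forall>y\<in>T'. \<exists>k::int. \<bar>f b x - f b y - of_int k\<bar> < real s / real L"
    using pigeonhole_arc[OF \<open>finite T\<close> \<open>s \<le> L\<close> \<open>0 < L\<close>, of "f b"] by blast
  have "s * (s ^ card B * card S) \<le> s * (L ^ card B * card T)"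
    using T(2) by (rule mult_le_mono2)
  also have "\<dots> = L ^ card B * (s * card T)"
    by (simp add: ac_simps)
  also have "\<dots> \<le> L ^ card B * (L * card T')"
    using T'(2) by (rule mult_le_mono2)
  finally have "s ^ card (insert b B) * card S \<le> L ^ card (insert b B) * card T'"
    using insert.hyps by (simp add: ac_simps)
  moreover have "\<forall>x\<in>T'. \<forall>y\<in>T'. \<forall>l\<in>insert b B. \<exists>k::int. \<bar>f l x - f l y - of_int k\<bar> < real s / real L"
    using T(3) T'(1,3) by (metis insert_iff subset_iff)
  ultimately show ?case
    using T(1) T'(1) by blast
qed

section \<open>Counting the intervals with a large minimum\<close>

lemma lattice_dist_less:
  fixes c :: "real ^ 'n"
  assumes "\<And>l. \<exists>k::int. \<bar>\<tau> * c $ l - of_int k\<bar> < q"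
  shows "lattice_dist c \<tau> < real CARD('n) * q"
proof -
  obtain k :: "'n \<Rightarrow> int" where k: "\<And>l. \<bar>\<tau> * c $ l - of_int (k l)\<bar> < q"
    using assms by metis
  define z :: "real ^ 'n" where "z = (\<chi> l. of_int (k l))"
  have "z \<in> int_lattice"
    by (simp add: z_def int_lattice_def)
  then have "lattice_dist c \<tau> \<le> l1_norm (\<tau> *\<^sub>R c - z)"
    using lattice_dist_attained[of c \<tau>] by auto
  also have "\<dots> < (\<Sum>l\<in>(UNIV :: 'n set). q)"
    unfolding l1_norm_def by (intro sum_strict_mono) (auto simp: z_def k)
  finally show ?thesis by simp
qed

lemma min_dist_le: "\<tau> \<in> dyadic_interval j \<Longrightarrow> min_dist c j \<le> lattice_dist c \<tau>"
  using min_dist_attained[of j c] by auto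

lemma min_dist_nonneg: "0 \<le> min_dist c j"
  using min_dist_attained[of j c] lattice_dist_attained l1_norm_nonneg by metis

lemma min_dist_le_half:
  fixes c :: "real ^ 'n"
  shows "min_dist c j \<le> real CARD('n) / 2"
proof (rule field_le_epsilon)
  fix e :: real assume "0 < e"
  obtain \<tau> where "\<tau> \<in> dyadic_interval j"
    using min_dist_attained by blast
  then have "min_dist c j \<le> lattice_dist c \<tau>"
    by (rule min_dist_le)
  also have "\<dots> < real CARD('n) * (1 / 2 + e / real CARD('n))"
  proof (rule lattice_dist_less)
    fix l :: 'n
    have "\<bar>\<tau> * c $ l - of_int (round (\<tau> * c $ l))\<bar> \<le> 1 / 2"
      using of_int_round_abs_le[of "\<tau> * c $ l"] by (simp add: abs_minus_commute)
    also have "\<dots> < 1 / 2 + e / real CARD('n)"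
      using \<open>0 < e\<close> by simp
    finally show "\<exists>k::int. \<bar>\<tau> * c $ l - of_int k\<bar> < 1 / 2 + e / real CARD('n)" ..
  qed
  finally show "min_dist c j \<le> real CARD('n) / 2 + e"
    by (simp add: algebra_simps)
qed

lemma dyadic_interval_grid:
  assumes "j < K" "2 ^ (K - Suc j) \<le> d" "d \<le> 2 ^ (K - j)"
  shows "real d / 2 ^ K \<in> dyadic_interval j"
proof -
  have "real (2 ^ (K - Suc j)) \<le> real d" "real d \<le> real (2 ^ (K - j))"
    using assms(2,3) by (simp_all only: of_nat_le_iff)
  then have d: "2 powr (real K - real j - 1) \<le> real d" "real d \<le> 2 powr (real K - real j)"
    using \<open>j < K\<close> by (simp_all add: powr_realpow[symmetric] of_nat_diff algebra_simps)
  have "2 powr (- real j - 1) = 2 powr (real K - real j - 1) / 2 ^ K"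
    "2 powr (- real j) = 2 powr (real K - real j) / 2 ^ K"
    by (simp_all add: powr_realpow[symmetric] powr_diff[symmetric])
  with d show ?thesis
    by (simp add: dyadic_interval_def divide_right_mono)
qed

lemma card_large_min_dist:
  fixes c :: "real ^ 'n" and s L :: nat
  assumes "finite J" "s \<le> L" "0 < L"
    and large: "\<And>j. j \<in> J \<Longrightarrow> real CARD('n) * (real s / real L) \<le> min_dist c j"
  shows "s ^ CARD('n) * 2 ^ card J \<le> L ^ CARD('n)"
proof -
  obtain K where K: "\<And>j. j \<in> J \<Longrightarrow> j < K"
    using \<open>finite J\<close> unfolding finite_nat_set_iff_bounded by blast
  obtain T where T: "T \<subseteq> {..<2 ^ K}" "s ^ CARD('n) * 2 ^ K \<le> L ^ CARD('n) * card T"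
    and close: "\<And>x y l. x \<in> T \<Longrightarrow> y \<in> T \<Longrightarrow>
      \<exists>k::int. \<bar>real x / 2 ^ K * c $ l - real y / 2 ^ K * c $ l - of_int k\<bar> < real s / real L"
    using pigeonhole_torus[OF finite_lessThan[of "2 ^ K"] \<open>s \<le> L\<close> \<open>0 < L\<close> finite_class.finite_UNIV,
        of "\<lambda>l x. real x / 2 ^ K * c $ (l :: 'n)"]
    unfolding card_lessThan by blast
  \<comment> \<open>A difference \<open>d / 2 ^ K\<close> with \<open>2 ^ b \<le> d \<le> 2 ^ (b + 1)\<close> lies in the interval number
    \<open>K - 1 - b\<close>.\<close>
  define B where "B = (\<lambda>j. K - Suc j) ` J"
  have "B \<subseteq> {..<K}"
    using K by (force simp: B_def)
  then have BK: "B \<inter> {..<K} = B" by blast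
  have "inj_on (\<lambda>j. K - Suc j) J"
  proof (rule inj_onI)
    fix i j assume "i \<in> J" "j \<in> J" "K - Suc i = K - Suc j"
    then show "i = j" using K[of i] K[of j] by linarith
  qed
  then have cardB: "card B = card J"
    by (simp add: B_def card_image)
  have "card T * 2 ^ card (B \<inter> {..<K}) \<le> 2 ^ K"
  proof (rule card_mult_le_of_gaps)
    show "finite T"
      using T(1) finite_subset by blast
  next
    fix x y assume "x \<in> T" "y \<in> T" "x < y"
    then show "y - x < 2 ^ K" using T(1) by auto
  next
    fix x y b
    assume xy: "x \<in> T" "y \<in> T" "x < y" and b: "b \<in> B" "2 ^ b \<le> y - x"
    obtain j where j: "j \<in> J" "b = K - Suc j"
      using b(1) by (auto simp: B_def)
    show "2 ^ Suc b \<le> y - x"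
    proof (rule ccontr)
      assume "\<not> ?thesis"
      moreover have "Suc b = K - j" using j K by (simp add: Suc_diff_Suc)
      ultimately have "y - x \<le> 2 ^ (K - j)" by simp
      then have "real (y - x) / 2 ^ K \<in> dyadic_interval j"
        using b j K by (intro dyadic_interval_grid) auto
      then have "min_dist c j \<le> lattice_dist c (real (y - x) / 2 ^ K)"
        by (rule min_dist_le)
      also have "\<dots> < real CARD('n) * (real s / real L)"
        using close[OF xy(2,1)] xy(3)
        by (intro lattice_dist_less) (simp add: of_nat_diff diff_divide_distrib left_diff_distrib)
      finally show False
        using large[OF j(1)] by simp
    qed
  qed
  then have "card T * 2 ^ card J \<le> 2 ^ K"
    by (simp add: BK cardB)
  then have T2: "L ^ CARD('n) * (card T * 2 ^ card J) \<le> L ^ CARD('n) * 2 ^ K"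
    by (rule mult_le_mono2)
  have "2 ^ K * (s ^ CARD('n) * 2 ^ card J) = s ^ CARD('n) * 2 ^ K * 2 ^ card J"
    by (simp only: ac_simps)
  also have "\<dots> \<le> L ^ CARD('n) * card T * 2 ^ card J"
    using T(2) by (rule mult_le_mono1)
  also have "\<dots> \<le> 2 ^ K * L ^ CARD('n)"
    using T2 by (simp only: ac_simps)
  finally show ?thesis by simp
qed

text \<open>The rational thresholds of \<open>card_large_min_dist\<close> are dense, which gives the bound for every
  real threshold. For empty \<open>J\<close> nothing would bound \<open>x\<close>.\<close>

lemma le_of_le_min_dist:
  fixes c :: "real ^ 'n"
  assumes "finite J" "J \<noteq> {}" and large: "\<And>j. j \<in> J \<Longrightarrow> x \<le> min_dist c j"
  shows "x \<le> real CARD('n) * (2 powr (- 1 / real CARD('n))) ^ card J"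
proof (rule ccontr)
  let ?n = "real CARD('n)" and ?r = "2 powr (- 1 / real CARD('n))"
  assume neg: "\<not> ?thesis"
  have n: "0 < ?n" by simp
  have "0 < card J"
    using assms(1,2) by (simp add: card_gt_0_iff)
  have "?r < 1"
    using powr_less_mono[of "- 1 / ?n" 0 "2::real"] n by simp
  then have "?r ^ card J < 1"
    using \<open>0 < card J\<close> power_strict_decreasing[of 0 "card J" ?r] by simp
  moreover have "?r ^ card J < x / ?n"
    using neg by (simp add: field_simps)
  ultimately obtain q where q: "q \<in> \<rat>" "?r ^ card J < q" "q < 1" "q < x / ?n"
    using Rats_dense_in_real[of "?r ^ card J" "min 1 (x / ?n)"] by auto
  have "0 < ?r ^ card J" by simp
  then have "0 < q" using q(2) by linarith
  obtain s L :: nat where sL: "L \<noteq> 0" "\<bar>q\<bar> = real s / real L"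
    using Rats_abs_nat_div_natE[OF q(1)] by blast
  then have sq: "q = real s / real L" using \<open>0 < q\<close> by simp
  have "s \<le> L"
    using \<open>q < 1\<close> sL(1) by (simp add: sq field_simps)
  then have "s ^ CARD('n) * 2 ^ card J \<le> L ^ CARD('n)"
  proof (rule card_large_min_dist[OF \<open>finite J\<close>])
    fix j assume "j \<in> J"
    have "?n * (real s / real L) \<le> x"
      using q(4) n by (simp add: sq[symmetric] field_simps)
    then show "?n * (real s / real L) \<le> min_dist c j"
      using large[OF \<open>j \<in> J\<close>] by linarith
  qed (use sL in simp)
  then have "real (s ^ CARD('n) * 2 ^ card J) \<le> real (L ^ CARD('n))"
    by (simp only: of_nat_le_iff)
  then have "q ^ CARD('n) * 2 ^ card J \<le> 1"
    using sL(1) by (simp add: sq power_divide field_simps)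
  moreover have "(?r ^ card J) ^ CARD('n) < q ^ CARD('n)"
    using q(2) by (intro power_strict_mono) auto
  moreover have "(?r ^ card J) ^ CARD('n) = (?r ^ CARD('n)) ^ card J"
    by (simp only: power_mult[symmetric] mult.commute)
  moreover have "?r ^ CARD('n) = 1 / 2"
    by (simp add: powr_power powr_minus field_simps)
  ultimately have "(1 / 2) ^ card J < q ^ CARD('n)"
    by metis
  then show False
    using \<open>q ^ CARD('n) * 2 ^ card J \<le> 1\<close> by (simp add: power_one_over field_simps)
qed

section \<open>Summation\<close>

text \<open>The \<open>k\<close>-th summand on the right bounds the \<open>k\<close>-th largest value of \<open>min_dist c\<close> on \<open>F\<close>. The
  induction removes an index with the smallest value, so that no sorting is needed.\<close>

lemma sum_min_dist_le:
  fixes c :: "real ^ 'n"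
  defines "r \<equiv> 2 powr (- 1 / real CARD('n))"
  assumes "finite F"
  shows "sum (min_dist c) F
    \<le> (\<Sum>k=1..card F. min (real CARD('n) / 2) (real CARD('n) * r ^ k))"
  using \<open>finite F\<close>
proof (induction "card F" arbitrary: F)
  case 0
  then show ?case by simp
next
  case (Suc N)
  let ?b = "\<lambda>k. min (real CARD('n) / 2) (real CARD('n) * r ^ k)"
  have ne: "F \<noteq> {}" using Suc.hyps(2) by auto
  obtain i where i: "i \<in> F" "\<And>j. j \<in> F \<Longrightarrow> min_dist c i \<le> min_dist c j"
    using arg_min_if_finite[OF Suc.prems ne, of "min_dist c"] by (metis not_le)
  have "card (F - {i}) = N" using Suc.hyps(2) i(1) by simp
  then have "sum (min_dist c) (F - {i}) \<le> sum ?b {1..N}"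
    using Suc.hyps(1)[of "F - {i}"] Suc.prems by simp
  moreover have "min_dist c i \<le> ?b (Suc N)"
    using le_of_le_min_dist[OF Suc.prems ne i(2)] min_dist_le_half[of c i]
    by (simp add: r_def Suc.hyps(2)[symmetric])
  ultimately have "min_dist c i + sum (min_dist c) (F - {i}) \<le> ?b (Suc N) + sum ?b {1..N}"
    by (intro add_mono)
  also have "\<dots> = sum ?b {1..card F}"
    by (simp add: Suc.hyps(2)[symmetric])
  finally show ?case
    using i(1) Suc.prems by (simp add: sum.remove)
qed

lemma sum_min_geometric_le:
  fixes n N :: nat
  assumes "0 < n"
  defines "r \<equiv> 2 powr (- 1 / real n)"
  shows "(\<Sum>k=1..N. min (real n / 2) (real n * r ^ k)) \<le> (1 / 2 + 1 / (2 * ln 2)) * (real n)\<^sup>2"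
proof -
  let ?b = "\<lambda>k. min (real n / 2) (real n * r ^ k)"
  have r: "0 < r" "r < 1"
    using powr_less_mono[of "- 1 / real n" 0 "2::real"] assms by (simp_all add: r_def)
  have rn: "r ^ n = 1 / 2"
    using assms by (simp add: r_def powr_power powr_minus field_simps)
  \<comment> \<open>Enlarging the range makes it contain the first \<open>n\<close> summands, whatever \<open>N\<close> is.\<close>
  have "sum ?b {1..N} \<le> sum ?b {1..n + N}"
    using r by (intro sum_mono2) auto
  also have "\<dots> = sum ?b {1..n} + sum ?b {n + 1..n + N}"
    by (rule sum.ub_add_nat) simp
  also have "sum ?b {1..n} \<le> (\<Sum>k=1..n. real n / 2)"
    by (intro sum_mono) simp
  also have "sum ?b {n + 1..n + N} \<le> (\<Sum>k=n + 1..n + N. real n * r ^ k)"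
    by (intro sum_mono) simp
  also have "\<dots> = (\<Sum>i<N. real n * r ^ (n + 1 + i))"
    by (rule sum.reindex_bij_witness[of _ "\<lambda>i. n + 1 + i" "\<lambda>k. k - (n + 1)"]) auto
  also have "\<dots> = (\<Sum>i<N. real n / 2 * r * r ^ i)"
    by (simp add: power_add rn mult.assoc)
  also have "\<dots> = real n / 2 * r * ((1 - r ^ N) / (1 - r))"
    using r by (subst sum_distrib_left[symmetric]) (simp add: sum_gp_strict)
  also have "\<dots> \<le> real n / 2 * r * (1 / (1 - r))"
    using r by (intro mult_left_mono divide_right_mono) auto
  also have "\<dots> \<le> real n / 2 * (real n / ln 2)"
  proof -
    have "1 + ln 2 / real n \<le> exp (ln 2 / real n)"
      by (rule exp_ge_add_one_self)
    also have "\<dots> = 1 / r"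
      by (simp add: r_def powr_def exp_minus field_simps)
    finally have "r * ln 2 \<le> real n * (1 - r)"
      using r assms by (simp add: field_simps)
    then have "r / (1 - r) \<le> real n / ln 2"
      using r by (simp add: field_simps)
    then show ?thesis
      using mult_left_mono[of "r / (1 - r)" "real n / ln 2" "real n / 2"] by simp
  qed
  finally show ?thesis
    by (simp add: field_simps power2_eq_square)
qed

lemma half_plus_half_inverse_ln_2_less: "1 / 2 + 1 / (2 * ln 2) < (1.222 :: real)"
proof -
  \<comment> \<open>The bound is equivalent to \<open>ln 2 > 500 / 722\<close>; three terms of the series for \<open>ln 2\<close> suffice.\<close>
  have "500 / 722 < ln (2 :: real)"
    using ln_approx_bounds[of 2 3, simplified, simplified eval_nat_numeral, simplified] by simp
  then show ?thesis by (simp add: field_simps)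
qed

theorem corollary6:
  fixes c :: "real ^ 'n"
  shows "summable (min_dist c)
    \<and> (\<Sum>j. min_dist c j) \<le> (1 / 2 + 1 / (2 * ln 2)) * (real CARD('n))\<^sup>2
    \<and> (1 / 2 + 1 / (2 * ln 2)) * (real CARD('n))\<^sup>2 < 1.222 * (real CARD('n))\<^sup>2"
proof (intro conjI)
  have partial: "sum (min_dist c) {..<N} \<le> (1 / 2 + 1 / (2 * ln 2)) * (real CARD('n))\<^sup>2" for N
    using sum_min_dist_le[of "{..<N}" c] sum_min_geometric_le[of "CARD('n)" N] by simp
  show summable: "summable (min_dist c)"
    using min_dist_nonneg partial by (rule summableI_nonneg_bounded)
  show "(\<Sum>j. min_dist c j) \<le> (1 / 2 + 1 / (2 * ln 2)) * (real CARD('n))\<^sup>2"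
    using summable partial by (rule suminf_le_const)
  show "(1 / 2 + 1 / (2 * ln 2)) * (real CARD('n))\<^sup>2 < 1.222 * (real CARD('n))\<^sup>2"
    using half_plus_half_inverse_ln_2_less by (intro mult_strict_right_mono) auto
qed

end
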